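(* Let $k$ be a field and $a_1,a_3,a_4,a_6\ge0$ integers. The ideal \[ (a,b)^{a_1}\cap(a,d)^{a_3}\cap(b,c)^{a_4}\cap(c,d)^{a_6}\subset k[a,b,c,d] \] defines an arithmetically Cohen-Macaulay curve in $\mathbb P^3$ if and only if the condition of the applicable case holds: Case 1. If $a_1,a_3,a_4,a_6>0$: $a_1+a_6=a_3+a_4+\epsilon$ for some $\epsilon\in\{-1,0,1\}$. Case 2. If exactly one of $a_1,a_3,a_4,a_6$ is zero, say $a_i$: $a_{7-i}+1$ is at least the sum of the weights of the lines meeting the line $\ell_i$. Case 3. If at least two of $a_1,a_3,a_4,a_6$ are zero: the curve is connected.
   Context: The lines are $\ell_1=V(a,b)$, $\ell_3=V(a,d)$, $\ell_4=V(b,c)$, $\ell_6=V(c,d)$ in $\mathbb P^3$, and $a_i$ is the weight of $\ell_i$. Among these four lines, $\ell_1$ and $\ell_6$ each meet exactly $\ell_3$ and $\ell_4$, and vice versa ($\ell_1,\ell_6$ are skew, $\ell_3,\ell_4$ are skew); so in Case 2 the sum of the weights of the lines meeting $\ell_i$ is $a_3+a_4$ if $i\in\{1,6\}$ and $a_1+a_6$ if $i\in\{3,4\}$. A curve $C$ is arithmetically Cohen-Macaulay if $H^1(\mathbb P^3,\mathcal I_C(t))=0$ for all $t\in\mathbb Z$. If all weights are zero one gets the trivial curve (empty set), which is regarded as arithmetically Cohen-Macaulay and as connected. *)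

theory Defs
  imports
    "HOL-Library.Poly_Mapping"
    "HOL-Computational_Algebra.Fraction_Field"
    "HOL-Analysis.Abstract_Topology"
begin

section \<open>The polynomial ring in four variables\<close>

datatype coord = CA | CB | CC | CD

text \<open>
  The order on coordinates serves only to provide the class instance \<open>idom\<close> for polynomials
  (and thereby the fraction field).
\<close>

instantiation coord :: linorder
begin

fun coord_index :: "coord \<Rightarrow> nat" where
  "coord_index CA = 0"
| "coord_index CB = 1"
| "coord_index CC = 2"
| "coord_index CD = 3"

definition less_eq_coord :: "coord \<Rightarrow> coord \<Rightarrow> bool" where
  "x \<le> y \<longleftrightarrow> coord_index x \<le> coord_index y"

definition less_coord :: "coord \<Rightarrow> coord \<Rightarrow> bool" where
  "x < y \<longleftrightarrow> coord_index x < coord_index y"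

instance
proof
  fix x y :: coord
  show "x \<le> y \<Longrightarrow> y \<le> x \<Longrightarrow> x = y"
    by (cases x; cases y) (simp_all add: less_eq_coord_def)
qed (auto simp: less_eq_coord_def less_coord_def)

end

lemma UNIV_coord: "UNIV = {CA, CB, CC, CD}"
  using coord.exhaust by blast

instance coord :: finite
  by standard (simp add: UNIV_coord)

type_synonym 'k mpoly4 = "(coord \<Rightarrow>\<^sub>0 nat) \<Rightarrow>\<^sub>0 'k"

definition X :: "coord \<Rightarrow> 'k::field mpoly4" where
  "X i = Poly_Mapping.single (Poly_Mapping.single i 1) 1"

definition homogeneous :: "nat \<Rightarrow> 'k::field mpoly4 \<Rightarrow> bool" where
  "homogeneous d f \<longleftrightarrow> (\<forall>m\<in>Poly_Mapping.keys f. (\<Sum>i\<in>UNIV. Poly_Mapping.lookup m i) = d)"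


section \<open>Ideals\<close>

text \<open>
  Ideals are the submodules of the ring as a module over itself: \<open>ideal.span S\<close> is the ideal
  generated by \<open>S\<close>, and \<open>ideal.subspace I\<close> says that \<open>I\<close> is an ideal.
\<close>

interpretation ideal: module "(*) :: 'a::comm_ring_1 \<Rightarrow> 'a \<Rightarrow> 'a"
  by standard (simp_all add: algebra_simps)

definition ideal_mult :: "'a::comm_ring_1 set \<Rightarrow> 'a set \<Rightarrow> 'a set" where
  "ideal_mult I J = ideal.span {x * y | x y. x \<in> I \<and> y \<in> J}"

fun ideal_power :: "'a::comm_ring_1 set \<Rightarrow> nat \<Rightarrow> 'a set" where
  "ideal_power I 0 = UNIV"
| "ideal_power I (Suc n) = ideal_mult I (ideal_power I n)"

definition prime_ideal :: "'a::comm_ring_1 set \<Rightarrow> bool" where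
  "prime_ideal P \<longleftrightarrow> ideal.subspace P \<and> P \<noteq> UNIV \<and>
     (\<forall>x y. x * y \<in> P \<longrightarrow> x \<in> P \<or> y \<in> P)"

definition homogeneous_ideal :: "'k::field mpoly4 set \<Rightarrow> bool" where
  "homogeneous_ideal I \<longleftrightarrow> (\<exists>S. (\<forall>f\<in>S. \<exists>d. homogeneous d f) \<and> I = ideal.span S)"


section \<open>Projective space as Proj of the polynomial ring\<close>

text \<open>
  The field is arbitrary, so the points are the homogeneous primes not containing the irrelevant
  ideal; the rational points alone would not give the right topology.
\<close>

definition proj_points :: "'k::field mpoly4 set set" where
  "proj_points = {P. prime_ideal P \<and> homogeneous_ideal P \<and> \<not> ideal.span (range X) \<subseteq> P}"

definition basic_open :: "'k::field mpoly4 \<Rightarrow> 'k mpoly4 set set" where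
  "basic_open f = {P \<in> proj_points. f \<notin> P}"

definition zariski :: "'k::field mpoly4 set topology" where
  "zariski = topology_generated_by {basic_open f | f. \<exists>d. homogeneous d f}"

definition V :: "'k::field mpoly4 set \<Rightarrow> 'k mpoly4 set set" where
  "V S = {P \<in> proj_points. S \<subseteq> P}"


section \<open>First cohomology of the twisted ideal sheaf\<close>

text \<open>
  For homogeneous \<open>f\<close> and an ideal \<open>I\<close>, the sections of the sheaf associated with \<open>I(t)\<close>
  over the basic open set of \<open>f\<close> form the degree \<open>t\<close> part of the localization of \<open>I\<close>
  at \<open>f\<close>, taken inside the fraction field of the polynomial ring.
\<close>

definition sections :: "'k::field mpoly4 set \<Rightarrow> int \<Rightarrow> 'k mpoly4 \<Rightarrow> 'k mpoly4 fract set" where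
  "sections I t f =
     {Fraction_Field.Fract g (f ^ n) | g n d e.
        g \<in> I \<and> homogeneous d g \<and> homogeneous e (f ^ n) \<and> int d - int e = t}"

text \<open>
  The first cohomology group is the first Cech cohomology group of the standard affine open
  cover by the four sets \<open>basic_open (X i)\<close>; for a quasi-coherent sheaf on projective space this is
  sheaf cohomology. All ordered pairs and triples of indices are used, so the cocycle condition
  forces cochains to be alternating. All restriction maps are inclusions in the fraction field.
\<close>

definition cech_cocycles1 ::
    "'k::field mpoly4 set \<Rightarrow> int \<Rightarrow> (coord \<Rightarrow> coord \<Rightarrow> 'k mpoly4 fract) set" where
  "cech_cocycles1 I t =
     {s. (\<forall>i j. s i j \<in> sections I t (X i * X j)) \<and> (\<forall>i j k. s j k - s i k + s i j = 0)}"

definition cech_coboundaries1 ::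
    "'k::field mpoly4 set \<Rightarrow> int \<Rightarrow> (coord \<Rightarrow> coord \<Rightarrow> 'k mpoly4 fract) set" where
  "cech_coboundaries1 I t =
     {\<lambda>i j. r j - r i | r. \<forall>i. r i \<in> sections I t (X i)}"

definition H1_vanishes :: "'k::field mpoly4 set \<Rightarrow> int \<Rightarrow> bool" where
  "H1_vanishes I t \<longleftrightarrow> cech_cocycles1 I t = cech_coboundaries1 I t"

text \<open>
  The argument is a homogeneous ideal defining the curve.
\<close>

definition arithmetically_Cohen_Macaulay :: "'k::field mpoly4 set \<Rightarrow> bool" where
  "arithmetically_Cohen_Macaulay I \<longleftrightarrow> (\<forall>t. H1_vanishes I t)"


section \<open>The weighted configuration of four lines\<close>

definition line_indices :: "nat set" where
  "line_indices = {1, 3, 4, 6}"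

text \<open>The value at indices outside \<open>line_indices\<close> is irrelevant.\<close>

definition line_forms :: "nat \<Rightarrow> 'k::field mpoly4 set" where
  "line_forms i =
     (if i = 1 then {X CA, X CB}
      else if i = 3 then {X CA, X CD}
      else if i = 4 then {X CB, X CC}
      else {X CC, X CD})"

definition curve_ideal :: "(nat \<Rightarrow> nat) \<Rightarrow> 'k::field mpoly4 set" where
  "curve_ideal a = (\<Inter>i\<in>line_indices. ideal_power (ideal.span (line_forms i)) (a i))"

definition lines_meeting :: "'k::field itself \<Rightarrow> nat \<Rightarrow> nat set" where
  "lines_meeting _ i =
     {j \<in> line_indices. j \<noteq> i \<and> V (line_forms i :: 'k mpoly4 set) \<inter> V (line_forms j) \<noteq> {}}"

end

(*
  All ideals in sight are monomial, so the Cech complex splits by exponents alpha in Z^4. Call a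
  line violated at alpha if the sum of the two exponents of its forms is less than its weight;
  the lines are the edges of the 4-cycle a, b, c, d. The part of H^1 at alpha is nonzero exactly
  if alpha is nonnegative and the violated lines are two opposite edges (the lines of a skew pair),
  the other two not being violated. Such an alpha exists for the pair l_1, l_6 iff a_1, a_6 > 0 and
  a_3 + a_4 + 2 <= a_1 + a_6, and symmetrically for l_3, l_4, which gives the three cases.

  For connectedness, the support is the union of the lines of positive weight; each line is
  irreducible, with generic point the prime generated by its two forms.
*)
theory Submission
  imports Defs
begin

section \<open>Exponents and monomials\<close>

abbreviation "keys \<equiv> Poly_Mapping.keys"
abbreviation "lookup \<equiv> Poly_Mapping.lookup"
abbreviation "single \<equiv> Poly_Mapping.single"

abbreviation mon :: "(coord \<Rightarrow>\<^sub>0 nat) \<Rightarrow> 'k::field mpoly4" where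
  "mon m \<equiv> single m 1"

text \<open>The degree of a monomial in the variables of \<open>S\<close>: its total degree for
  \<open>S = UNIV\<close>, its order of vanishing along a line when \<open>S\<close> consists of the
  variables vanishing on that line.\<close>

definition wt :: "coord set \<Rightarrow> (coord \<Rightarrow>\<^sub>0 nat) \<Rightarrow> nat" where
  "wt S m = (\<Sum>i\<in>S. lookup m i)"

lemma wt_add [simp]: "wt S (m + n) = wt S m + wt S n"
  by (simp add: wt_def lookup_add sum.distrib)

lemma wt_zero [simp]: "wt S 0 = 0"
  by (simp add: wt_def)

lemma wt_single [simp]: "wt S (single i n) = (if i \<in> S then n else 0)"
  by (simp add: wt_def lookup_single when_def sum.delta)

lemma wt_gt_0_iff: "0 < wt S m \<longleftrightarrow> (\<exists>i\<in>S. 0 < lookup m i)"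
  by (auto simp: wt_def sum_pos2 intro: ccontr)

lemma exponent_decomp:
  fixes \<mu> \<beta> :: "coord \<Rightarrow>\<^sub>0 nat"
  assumes "\<And>i. lookup \<mu> i \<le> lookup \<beta> i"
  shows "\<beta> - \<mu> + \<mu> = \<beta>"
  by (rule poly_mapping_eqI) (simp add: lookup_add lookup_minus assms)

lemma homogeneous_iff_wt: "homogeneous d f \<longleftrightarrow> (\<forall>m\<in>keys f. wt UNIV m = d)"
  by (simp add: homogeneous_def wt_def)

lemma poly_eq_sum_monomials:
  fixes f :: "'k::field mpoly4"
  shows "f = (\<Sum>m\<in>keys f. single m (lookup f m))"
proof (rule poly_mapping_eqI)
  fix n
  show "lookup f n = lookup (\<Sum>m\<in>keys f. single m (lookup f m)) n"
    by (auto simp: lookup_sum lookup_single when_def sum.delta in_keys_iff)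
qed

lemma lookup_mult_mon [simp]:
  "lookup (f * mon \<mu>) (m + \<mu>) = lookup f m" for f :: "'k::field mpoly4"
proof -
  have "f * mon \<mu> = (\<Sum>n\<in>keys f. single (n + \<mu>) (lookup f n))"
    by (subst (1) poly_eq_sum_monomials[of f]) (simp add: sum_distrib_right mult_single)
  then show ?thesis
    by (auto simp: lookup_sum lookup_single when_def sum.delta in_keys_iff)
qed

lemma keys_mult_mon: "keys (f * mon \<mu>) = (\<lambda>m. m + \<mu>) ` keys f" for f :: "'k::field mpoly4"
proof
  show "keys (f * mon \<mu>) \<subseteq> (\<lambda>m. m + \<mu>) ` keys f"
    using keys_mult[of f "mon \<mu>"] by auto
  show "(\<lambda>m. m + \<mu>) ` keys f \<subseteq> keys (f * mon \<mu>)"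
    by (auto simp: in_keys_iff)
qed

lemma mon_dvd:
  fixes G :: "'k::field mpoly4"
  assumes "\<And>\<beta> i. \<beta> \<in> keys G \<Longrightarrow> lookup \<mu> i \<le> lookup \<beta> i"
  obtains g where "G = g * mon \<mu>"
proof
  show "G = (\<Sum>\<beta>\<in>keys G. single (\<beta> - \<mu>) (lookup G \<beta>)) * mon \<mu>"
    by (subst (1) poly_eq_sum_monomials[of G])
      (simp add: sum_distrib_right mult_single exponent_decomp assms)
qed

text \<open>Every function is an exponent vector, because \<open>coord\<close> is finite.\<close>

definition expvec :: "(coord \<Rightarrow> nat) \<Rightarrow> coord \<Rightarrow>\<^sub>0 nat" where
  "expvec f = Poly_Mapping.Abs_poly_mapping f"

lemma lookup_expvec [simp]: "lookup (expvec f) = f"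
  by (simp add: expvec_def)

lemma wt_expvec [simp]: "wt S (expvec f) = sum f S"
  by (simp add: wt_def)

lemma mon_power: "mon m ^ n = (mon (expvec (\<lambda>i. n * lookup m i)) :: 'k::field mpoly4)"
proof (induction n)
  case 0
  have "expvec (\<lambda>i. 0) = 0" by (rule poly_mapping_eqI) simp
  then show ?case by simp
next
  case (Suc n)
  have "m + expvec (\<lambda>i. n * lookup m i) = expvec (\<lambda>i. Suc n * lookup m i)"
    by (rule poly_mapping_eqI) (simp add: lookup_add)
  then show ?case using Suc by (simp add: mult_single)
qed

lemma mon_neq_0 [simp]: "mon m \<noteq> (0 :: 'k::field mpoly4)"
  by (metis lookup_single_eq lookup_zero zero_neq_one)

section \<open>Monomial ideals\<close>

text \<open>Exponents of a product are sums of exponents of the factors, so a condition stable under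
  enlarging the exponent survives multiplication.\<close>

lemma subspace_monomial:
  assumes "\<And>m n. P m \<Longrightarrow> P (m + n)"
  shows "ideal.subspace {f :: 'k::field mpoly4. \<forall>m\<in>keys f. P m}"
proof (rule ideal.subspaceI)
  fix x y :: "'k mpoly4"
  show "x \<in> {f. \<forall>m\<in>keys f. P m} \<Longrightarrow> y \<in> {f. \<forall>m\<in>keys f. P m} \<Longrightarrow> x + y \<in> {f. \<forall>m\<in>keys f. P m}"
    using keys_add[of x y] by auto
  show "x \<in> {f. \<forall>m\<in>keys f. P m} \<Longrightarrow> y * x \<in> {f. \<forall>m\<in>keys f. P m}"
    using keys_mult[of y x] assms by (force simp: add.commute)
qed simp

text \<open>Every polynomial is a sum of constants times monomials. Together with
  \<open>subspace_monomial\<close> this identifies monomial ideals.\<close>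

lemma monomial_subset_ideal:
  fixes J :: "'k::field mpoly4 set"
  assumes "ideal.subspace J" and "\<And>m. P m \<Longrightarrow> mon m \<in> J"
  shows "{f. \<forall>m\<in>keys f. P m} \<subseteq> J"
proof
  fix f :: "'k mpoly4"
  assume f: "f \<in> {f. \<forall>m\<in>keys f. P m}"
  have "single m (lookup f m) \<in> J" if "m \<in> keys f" for m
  proof -
    have "single 0 (lookup f m) * mon m \<in> J"
      using f that assms by (intro ideal.subspace_scale) auto
    then show ?thesis by (simp add: mult_single)
  qed
  then show "f \<in> J"
    by (subst poly_eq_sum_monomials) (auto intro: ideal.subspace_sum assms(1))
qed

lemma subspace_ideal_power: "ideal.subspace (ideal_power I n)"
  by (cases n) (auto simp: ideal_mult_def)

lemma span_vars_eq: "ideal.span (X ` S) = {f :: 'k::field mpoly4. \<forall>m\<in>keys f. 0 < wt S m}"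
proof
  show "ideal.span (X ` S) \<subseteq> {f :: 'k mpoly4. \<forall>m\<in>keys f. 0 < wt S m}"
    by (rule ideal.span_minimal) (auto simp: X_def intro: subspace_monomial)
  show "{f :: 'k mpoly4. \<forall>m\<in>keys f. 0 < wt S m} \<subseteq> ideal.span (X ` S)"
  proof (rule monomial_subset_ideal)
    fix m
    assume "0 < wt S m"
    then obtain i where i: "i \<in> S" "0 < lookup m i" by (auto simp: wt_gt_0_iff)
    have "m - single i 1 + single i 1 = m"
      by (rule exponent_decomp) (use i in \<open>auto simp: lookup_single when_def\<close>)
    then have "(mon m :: 'k mpoly4) = mon (m - single i 1) * X i"
      by (simp add: X_def mult_single)
    then show "(mon m :: 'k mpoly4) \<in> ideal.span (X ` S)"
      using i by (simp add: ideal.span_base ideal.span_scale)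
  qed auto
qed

text \<open>A monomial of degree at least \<open>Suc n\<close> in \<open>S\<close> splits off one
  variable of \<open>S\<close> and keeps degree at least \<open>n\<close>; conversely, degrees in
  \<open>S\<close> add up in products.\<close>

lemma ideal_power_vars_eq:
  "ideal_power (ideal.span (X ` S)) n = {f :: 'k::field mpoly4. \<forall>m\<in>keys f. n \<le> wt S m}"
proof (induction n)
  case 0
  then show ?case by simp
next
  case (Suc n)
  let ?P = "ideal_power (ideal.span (X ` S :: 'k mpoly4 set))"
  show ?case
  proof
    have "x * y \<in> {f. \<forall>m\<in>keys f. Suc n \<le> wt S m}"
      if "x \<in> ideal.span (X ` S)" "y \<in> ?P n" for x y :: "'k mpoly4"
    proof -
      have "0 < wt S m" if "m \<in> keys x" for m
        using that \<open>x \<in> _\<close> by (simp add: span_vars_eq)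
      moreover have "n \<le> wt S m" if "m \<in> keys y" for m
        using that \<open>y \<in> _\<close> by (simp add: Suc)
      ultimately show ?thesis
        using keys_mult[of x y] by (fastforce simp: Suc_le_eq intro: add_less_le_mono[of 0, simplified])
    qed
    then have "{x * y |x y. x \<in> ideal.span (X ` S) \<and> y \<in> ?P n} \<subseteq> {f. \<forall>m\<in>keys f. Suc n \<le> wt S m}"
      by blast
    then show "?P (Suc n) \<subseteq> {f. \<forall>m\<in>keys f. Suc n \<le> wt S m}"
      unfolding ideal_power.simps ideal_mult_def
      by (rule ideal.span_minimal) (rule subspace_monomial, simp)
    show "{f. \<forall>m\<in>keys f. Suc n \<le> wt S m} \<subseteq> ?P (Suc n)"
    proof (rule monomial_subset_ideal[OF subspace_ideal_power])
      fix m
      assume m: "Suc n \<le> wt S m"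
      then obtain i where i: "i \<in> S" "0 < lookup m i" using wt_gt_0_iff[of S m] by auto
      have e: "m - single i 1 + single i 1 = m"
        by (rule exponent_decomp) (use i in \<open>auto simp: lookup_single when_def\<close>)
      then have "wt S (m - single i 1) + 1 = wt S m"
        using i(1) wt_add[of S "m - single i 1" "single i 1"] by simp
      then have "(mon (m - single i 1) :: 'k mpoly4) \<in> ?P n"
        using m by (simp add: Suc)
      moreover have "X i \<in> ideal.span (X ` S :: 'k mpoly4 set)"
        using i by (simp add: ideal.span_base)
      moreover have "mon m = X i * (mon (m - single i 1) :: 'k mpoly4)"
        using e by (simp add: X_def mult_single add.commute)
      ultimately show "(mon m :: 'k mpoly4) \<in> ?P (Suc n)"
        unfolding ideal_power.simps ideal_mult_def by (intro ideal.span_base) blast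
    qed
  qed
qed

section \<open>The lines and the curve as monomial conditions\<close>

definition line_vars :: "nat \<Rightarrow> coord set" where
  "line_vars i =
     (if i = 1 then {CA, CB} else if i = 3 then {CA, CD} else if i = 4 then {CB, CC} else {CC, CD})"

lemma line_vars_simps [simp]:
  "line_vars 1 = {CA, CB}" "line_vars (Suc 0) = {CA, CB}" "line_vars 3 = {CA, CD}"
  "line_vars 4 = {CB, CC}" "line_vars 6 = {CC, CD}"
  by (simp_all add: line_vars_def)

lemma line_forms_eq: "line_forms i = X ` line_vars i"
  by (simp add: line_forms_def line_vars_def)

text \<open>An intersection of monomial ideals is monomial, so membership is decided exponent by
  exponent; this is what splits the Cech complex.\<close>

lemma mem_curve_ideal_iff:
  "f \<in> curve_ideal a \<longleftrightarrow> (\<forall>m\<in>keys f. \<forall>i\<in>line_indices. a i \<le> wt (line_vars i) m)"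
  by (auto simp: curve_ideal_def line_forms_eq ideal_power_vars_eq)

section \<open>Sections over the basic open sets\<close>

definition const_vec :: "nat \<Rightarrow> coord \<Rightarrow>\<^sub>0 nat" where
  "const_vec n = expvec (\<lambda>_. n)"

lemma lookup_const_vec [simp]: "lookup (const_vec n) i = n"
  by (simp add: const_vec_def)

lemma wt_const_vec: "wt S (const_vec n) = card S * n"
  by (simp add: wt_def)

lemma card_UNIV_coord [simp]: "card (UNIV :: coord set) = 4"
  by (simp add: UNIV_coord)

lemma card_line_vars [simp]: "card (line_vars i) = 2"
  by (simp add: line_vars_def)

lemma const_vec_0 [simp]: "const_vec 0 = 0"
  by (rule poly_mapping_eqI) simp

text \<open>
  All fractions are written over the common denominator \<open>(X CA * X CB * X CC * X CD) ^ n\<close>, so an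
  exponent \<open>\<beta>\<close> of a numerator stands for the exponent \<open>\<beta> - (n, n, n, n)\<close> of the fraction. It is
  admissible if the corresponding monomial lies in the localization of the ideal at the variables
  in \<open>F\<close>: these variables become units, and every line containing one of them in its ideal
  imposes no condition.
\<close>

definition admissible :: "(nat \<Rightarrow> nat) \<Rightarrow> nat \<Rightarrow> coord set \<Rightarrow> (coord \<Rightarrow>\<^sub>0 nat) \<Rightarrow> bool" where
  "admissible a n F \<beta> \<longleftrightarrow>
     (\<forall>k. k \<notin> F \<longrightarrow> n \<le> lookup \<beta> k) \<and>
     (\<forall>i\<in>line_indices. line_vars i \<inter> F = {} \<longrightarrow> a i + 2 * n \<le> wt (line_vars i) \<beta>)"

text \<open>The denominator \<open>mon (const_vec n)\<close> has degree \<open>4 * n\<close>, which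
  turns degree \<open>t\<close> of the fraction into degree \<open>t + 4 * int n\<close> of the
  numerator.\<close>

definition local_numerator ::
    "(nat \<Rightarrow> nat) \<Rightarrow> int \<Rightarrow> coord set \<Rightarrow> nat \<Rightarrow> 'k::field mpoly4 \<Rightarrow> bool" where
  "local_numerator a t F n G \<longleftrightarrow>
     (\<forall>\<beta>\<in>keys G. int (wt UNIV \<beta>) = t + 4 * int n \<and> admissible a n F \<beta>)"

lemma admissible_mono: "admissible a n F \<beta> \<Longrightarrow> F \<subseteq> F' \<Longrightarrow> admissible a n F' \<beta>"
  unfolding admissible_def by blast

lemma wt_eq_0: "S \<inter> keys m = {} \<Longrightarrow> wt S m = 0"
  unfolding wt_def by (rule sum.neutral) (auto simp: in_keys_iff)

lemma lookup_le_wt: "i \<in> S \<Longrightarrow> lookup m i \<le> wt S m"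
  unfolding wt_def by (rule member_le_sum) auto

text \<open>Inverting \<open>mon \<mu>\<close> inverts the variables in \<open>keys \<mu>\<close>.
  The conclusion covers all large \<open>n\<close>, so that finitely many sections can share one
  denominator.\<close>

lemma sectionsD:
  fixes \<mu> :: "coord \<Rightarrow>\<^sub>0 nat"
  assumes "z \<in> sections (curve_ideal a :: 'k::field mpoly4 set) t (mon \<mu>)"
  obtains n0 where "\<And>n. n0 \<le> n \<Longrightarrow>
    \<exists>G. z = Fraction_Field.Fract G (mon (const_vec n)) \<and> local_numerator a t (keys \<mu>) n G"
proof -
  obtain g m d e where z: "z = Fraction_Field.Fract g (mon \<mu> ^ m)" and g: "g \<in> curve_ideal a"
    and d: "homogeneous d g" and e: "homogeneous e (mon \<mu> ^ m :: 'k mpoly4)"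
    and t: "int d - int e = t"
    using assms unfolding sections_def by blast
  define \<nu> where "\<nu> = expvec (\<lambda>i. m * lookup \<mu> i)"
  have pow: "mon \<mu> ^ m = (mon \<nu> :: 'k mpoly4)" by (simp add: \<nu>_def mon_power)
  have e': "wt UNIV \<nu> = e" using e by (simp add: pow homogeneous_iff_wt)
  have "\<exists>G. z = Fraction_Field.Fract G (mon (const_vec n)) \<and> local_numerator a t (keys \<mu>) n G"
    if n: "e \<le> n" for n
  proof -
    define \<gamma> where "\<gamma> = const_vec n - \<nu>"
    \<comment> \<open>Each exponent of \<open>\<nu>\<close> is at most its total degree
      \<open>e\<close>, so \<open>mon \<nu>\<close> divides the new denominator, with cofactor
      \<open>mon \<gamma>\<close>.\<close>
    have "lookup \<nu> i \<le> n" for i using lookup_le_wt[of i UNIV \<nu>] n e' by simp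
    then have \<gamma>: "\<gamma> + \<nu> = const_vec n" unfolding \<gamma>_def by (intro exponent_decomp) simp
    have wt: "wt S \<gamma> + wt S \<nu> = card S * n" for S
      unfolding wt_add[symmetric] \<gamma> wt_const_vec ..
    have keys_\<nu>: "keys \<nu> \<subseteq> keys \<mu>" by (auto simp: \<nu>_def in_keys_iff)
    have "z = Fraction_Field.Fract (g * mon \<gamma>) (mon (const_vec n))"
      by (simp add: z pow eq_fract mult.assoc mult_single \<gamma>[symmetric])
    moreover have "local_numerator a t (keys \<mu>) n (g * mon \<gamma>)"
      unfolding local_numerator_def keys_mult_mon admissible_def
    proof (intro ballI conjI allI impI; elim imageE)
      fix \<beta> m assume \<beta>: "\<beta> = m + \<gamma>" "m \<in> keys g"
      then show "int (wt UNIV \<beta>) = t + 4 * int n"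
        using d t e' wt[of UNIV] by (simp add: homogeneous_iff_wt)
    next
      fix \<beta> k m assume \<beta>: "\<beta> = m + \<gamma>" and "k \<notin> keys \<mu>"
      then have "lookup \<nu> k = 0" using keys_\<nu> by (auto simp: in_keys_iff)
      then show "n \<le> lookup \<beta> k" by (simp add: \<beta> lookup_add \<gamma>_def lookup_minus)
    next
      fix \<beta> i m assume \<beta>: "\<beta> = m + \<gamma>" "m \<in> keys g"
        and i: "i \<in> line_indices" "line_vars i \<inter> keys \<mu> = {}"
      \<comment> \<open>\<open>\<nu>\<close> involves no variable of this line, so the cofactor
        contributes exactly \<open>n\<close> for each of its two variables.\<close>
      then have "wt (line_vars i) \<gamma> = 2 * n"
        using wt_eq_0[of "line_vars i" \<nu>] keys_\<nu> wt[of "line_vars i"] by fastforce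
      then show "a i + 2 * n \<le> wt (line_vars i) \<beta>"
        using g i \<beta> by (simp add: mem_curve_ideal_iff)
    qed
    ultimately show ?thesis by blast
  qed
  then show thesis by (rule that)
qed

text \<open>Expanding by a high power of \<open>mon \<mu>\<close> makes the exponents of the
  inverted variables large enough to meet every condition that involves them; admissibility provides
  the other conditions.\<close>

lemma sectionsI:
  fixes G :: "'k::field mpoly4"
  assumes G: "local_numerator a t (keys \<mu>) n G" and "\<mu> \<noteq> 0"
  shows "Fraction_Field.Fract G (mon (const_vec n)) \<in> sections (curve_ideal a) t (mon \<mu>)"
proof -
  \<comment> \<open>\<open>2 * n\<close> pays for the old denominator on a line, the sum of the
    weights covers \<open>a i\<close> for every line, and \<open>nat \<bar>t\<bar>\<close> keeps the
    degree of the new numerator nonnegative.\<close>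
  define N where "N = 2 * n + (\<Sum>i\<in>line_indices. a i) + nat \<bar>t\<bar>"
  define \<nu> where "\<nu> = expvec (\<lambda>i. N * lookup \<mu> i)"
  have pow: "mon \<mu> ^ N = (mon \<nu> :: 'k mpoly4)" by (simp add: \<nu>_def mon_power)
  have \<nu>_ge: "N \<le> lookup \<nu> k" if "k \<in> keys \<mu>" for k
    using that by (auto simp: \<nu>_def in_keys_iff)
  have wt_ge: "N \<le> wt S \<nu>" if "S \<inter> keys \<mu> \<noteq> {}" for S
    using that \<nu>_ge lookup_le_wt[of _ S \<nu>] le_trans by blast
  obtain g where g: "G * mon \<nu> = g * mon (const_vec n)"
  proof (rule mon_dvd[of "G * mon \<nu>" "const_vec n"])
    fix \<beta> k assume "\<beta> \<in> keys (G * mon \<nu>)"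
    then obtain m where m: "m \<in> keys G" "\<beta> = m + \<nu>" by (auto simp: keys_mult_mon)
    show "lookup (const_vec n) k \<le> lookup \<beta> k"
      using G m \<nu>_ge[of k]
      by (cases "k \<in> keys \<mu>")
        (auto simp: local_numerator_def admissible_def lookup_add N_def intro: trans_le_add1)
  qed
  have key: "\<exists>\<beta>\<in>keys G. m + const_vec n = \<beta> + \<nu>" if "m \<in> keys g" for m
    using that keys_mult_mon[of g "const_vec n"] keys_mult_mon[of G \<nu>] g by auto
  have "g \<in> curve_ideal a"
    unfolding mem_curve_ideal_iff
  proof (intro ballI)
    fix m i assume "m \<in> keys g" and i: "i \<in> line_indices"
    then obtain \<beta> where \<beta>: "\<beta> \<in> keys G" "m + const_vec n = \<beta> + \<nu>" using key by blast
    have eq: "wt (line_vars i) m + 2 * n = wt (line_vars i) \<beta> + wt (line_vars i) \<nu>"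
      using arg_cong[OF \<beta>(2), of "wt (line_vars i)"] by (simp add: wt_const_vec)
    have "a i \<le> (\<Sum>i\<in>line_indices. a i)"
      using i by (intro member_le_sum) (auto simp: line_indices_def)
    moreover have "a i + 2 * n \<le> wt (line_vars i) \<beta>" if "line_vars i \<inter> keys \<mu> = {}"
      using G \<beta>(1) i that by (simp add: local_numerator_def admissible_def)
    ultimately show "a i \<le> wt (line_vars i) m"
      using eq wt_ge[of "line_vars i"]
      by (cases "line_vars i \<inter> keys \<mu> = {}") (simp_all add: N_def)
  qed
  moreover have "homogeneous (nat (t + int (wt UNIV \<nu>))) g"
    unfolding homogeneous_iff_wt
  proof
    fix m assume "m \<in> keys g"
    then obtain \<beta> where \<beta>: "\<beta> \<in> keys G" "m + const_vec n = \<beta> + \<nu>" using key by blast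
    have "wt UNIV m + 4 * n = wt UNIV \<beta> + wt UNIV \<nu>"
      using arg_cong[OF \<beta>(2), of "wt UNIV"] by (simp add: wt_const_vec)
    moreover have "int (wt UNIV \<beta>) = t + 4 * int n"
      using G \<beta>(1) by (simp add: local_numerator_def)
    ultimately show "wt UNIV m = nat (t + int (wt UNIV \<nu>))"
      by linarith
  qed
  moreover have "homogeneous (wt UNIV \<nu>) (mon \<mu> ^ N :: 'k mpoly4)"
    by (simp add: pow homogeneous_iff_wt)
  \<comment> \<open>As \<open>\<mu>\<close> is nonzero, the degree of \<open>\<nu>\<close> is at
    least \<open>N\<close>, so \<open>nat\<close> truncates nothing.\<close>
  moreover have "keys \<mu> \<noteq> {}"
    using \<open>\<mu> \<noteq> 0\<close> by (metis poly_mapping_eqI in_keys_iff lookup_zero empty_iff)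
  then have "int (nat (t + int (wt UNIV \<nu>))) - int (wt UNIV \<nu>) = t"
    using wt_ge[of UNIV] by (simp add: N_def)
  moreover have "Fraction_Field.Fract G (mon (const_vec n)) = Fraction_Field.Fract g (mon \<mu> ^ N)"
    by (simp add: pow eq_fract g)
  ultimately show ?thesis
    unfolding sections_def mem_Collect_eq by (intro exI conjI)
qed

lemma X_eq_mon: "X i = mon (single i 1)"
  by (simp add: X_def)

lemma X_mult_X_eq_mon: "X i * X j = mon (single i 1 + single j 1)"
  by (simp add: X_def mult_single)

lemma keys_single_plus_single: "keys (single i (1::nat) + single j 1) = {i, j}"
  by (auto simp: in_keys_iff lookup_add lookup_single when_def split: if_splits)

lemma single_plus_single_neq_0: "single i (1::nat) + single j 1 \<noteq> 0"
  using keys_single_plus_single[of i j] by auto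

lemma single_neq_0: "single i (1::nat) \<noteq> 0"
  by (metis keys_single keys_zero insert_not_empty zero_neq_one)

lemma sections_XD:
  fixes r :: "coord \<Rightarrow> 'k::field mpoly4 fract"
  assumes "\<forall>i. r i \<in> sections (curve_ideal a) t (X i)"
  obtains n G where "\<And>i. r i = Fraction_Field.Fract (G i) (mon (const_vec n))"
    and "\<And>i. local_numerator a t {i} n (G i)"
proof -
  have "\<exists>n0. \<forall>n\<ge>n0. \<exists>G. r i = Fraction_Field.Fract G (mon (const_vec n)) \<and> local_numerator a t {i} n G"
    for i
    using assms sectionsD[of "r i" a t "single i 1"] by (metis X_eq_mon keys_single zero_neq_one)
  then obtain n0 where n0: "\<And>i n. n0 i \<le> n \<Longrightarrow>
      \<exists>G. r i = Fraction_Field.Fract G (mon (const_vec n)) \<and> local_numerator a t {i} n G"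
    by metis
  \<comment> \<open>The sum bounds each \<open>n0 i\<close>, so one denominator serves all four
    indices.\<close>
  define n where "n = (\<Sum>i\<in>UNIV. n0 i)"
  have "n0 i \<le> n" for i unfolding n_def by (rule member_le_sum) auto
  then have "\<exists>G. r i = Fraction_Field.Fract G (mon (const_vec n)) \<and> local_numerator a t {i} n G" for i
    by (rule n0)
  then obtain G where "r i = Fraction_Field.Fract (G i) (mon (const_vec n)) \<and> local_numerator a t {i} n (G i)" for i
    by metis
  then show thesis using that[of G n] by blast
qed

lemma sections_XXD:
  fixes s :: "coord \<Rightarrow> coord \<Rightarrow> 'k::field mpoly4 fract"
  assumes "\<forall>i j. s i j \<in> sections (curve_ideal a) t (X i * X j)"
  obtains n G where "\<And>i j. s i j = Fraction_Field.Fract (G i j) (mon (const_vec n))"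
    and "\<And>i j. local_numerator a t {i, j} n (G i j)"
proof -
  have "\<exists>n0. \<forall>n\<ge>n0. \<exists>G. s i j = Fraction_Field.Fract G (mon (const_vec n)) \<and> local_numerator a t {i, j} n G"
    for i j
    using assms sectionsD[of "s i j" a t "single i 1 + single j 1"]
    by (metis X_mult_X_eq_mon keys_single_plus_single)
  then obtain n0 where n0: "\<And>i j n. n0 i j \<le> n \<Longrightarrow>
      \<exists>G. s i j = Fraction_Field.Fract G (mon (const_vec n)) \<and> local_numerator a t {i, j} n G"
    by metis
  define n where "n = (\<Sum>(i, j)\<in>UNIV. n0 i j)"
  have "n0 i j \<le> n" for i j
    using member_le_sum[of "(i, j)" UNIV "\<lambda>(i, j). n0 i j"] by (simp add: n_def)
  then have "\<exists>G. s i j = Fraction_Field.Fract G (mon (const_vec n)) \<and> local_numerator a t {i, j} n G" for i j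
    by (rule n0)
  then obtain G where "s i j = Fraction_Field.Fract (G i j) (mon (const_vec n)) \<and>
      local_numerator a t {i, j} n (G i j)" for i j
    by metis
  then show thesis using that[of G n] by blast
qed

lemma sections_XI:
  "local_numerator a t {i} n G \<Longrightarrow>
     Fraction_Field.Fract G (mon (const_vec n)) \<in> sections (curve_ideal a) t (X i)"
  unfolding X_eq_mon by (rule sectionsI) (simp_all add: single_neq_0 del: One_nat_def)

lemma sections_XXI:
  "local_numerator a t {i, j} n G \<Longrightarrow>
     Fraction_Field.Fract G (mon (const_vec n)) \<in> sections (curve_ideal a) t (X i * X j)"
  unfolding X_mult_X_eq_mon
  by (rule sectionsI) (simp_all add: keys_single_plus_single single_plus_single_neq_0 del: One_nat_def)

lemma Fract_diff_same:
  fixes m :: "'a::idom"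
  assumes "m \<noteq> 0"
  shows "Fraction_Field.Fract x m - Fraction_Field.Fract y m = Fraction_Field.Fract (x - y) m"
proof -
  have "Fraction_Field.Fract x m - Fraction_Field.Fract y m = Fraction_Field.Fract (m * (x - y)) (m * m)"
    by (subst diff_fract[OF assms assms]) (simp only: right_diff_distrib mult.commute)
  then show ?thesis by (simp only: mult_fract_cancel[OF assms])
qed

lemma Fract_add_same:
  fixes m :: "'a::idom"
  assumes "m \<noteq> 0"
  shows "Fraction_Field.Fract x m + Fraction_Field.Fract y m = Fraction_Field.Fract (x + y) m"
proof -
  have "Fraction_Field.Fract x m + Fraction_Field.Fract y m = Fraction_Field.Fract (m * (x + y)) (m * m)"
    by (subst add_fract[OF assms assms]) (simp only: distrib_left mult.commute)
  then show ?thesis by (simp only: mult_fract_cancel[OF assms])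
qed

lemma Fract_same_eq_0_iff:
  fixes m :: "'a::idom"
  assumes "m \<noteq> 0"
  shows "Fraction_Field.Fract x m = 0 \<longleftrightarrow> x = 0"
  using assms by (simp add: eq_fract(1) Zero_fract_def)

text \<open>Restricting to an overlap inverts more variables, which only weakens admissibility; the
  cocycle identity telescopes.\<close>

lemma coboundaries_subset_cocycles:
  "cech_coboundaries1 (curve_ideal a :: 'k::field mpoly4 set) t \<subseteq> cech_cocycles1 (curve_ideal a) t"
proof
  fix s assume "s \<in> cech_coboundaries1 (curve_ideal a :: 'k mpoly4 set) t"
  then obtain r where s: "s = (\<lambda>i j. r j - r i)"
    and r: "\<forall>i. r i \<in> sections (curve_ideal a :: 'k mpoly4 set) t (X i)"
    by (auto simp: cech_coboundaries1_def)
  obtain n G where G: "\<And>i. r i = Fraction_Field.Fract (G i) (mon (const_vec n))"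
    "\<And>i. local_numerator a t {i} n (G i)"
    by (rule sections_XD[OF r]) (rule that)
  have "local_numerator a t {i, j} n (G j - G i)" for i j
    unfolding local_numerator_def
  proof
    fix \<beta> assume "\<beta> \<in> keys (G j - G i)"
    then have "\<beta> \<in> keys (G j) \<or> \<beta> \<in> keys (G i)" using keys_diff[of "G j" "G i"] by auto
    then show "int (wt UNIV \<beta>) = t + 4 * int n \<and> admissible a n {i, j} \<beta>"
      using G(2)[of i] G(2)[of j] admissible_mono[of a n _ \<beta> "{i, j}"]
      by (auto simp: local_numerator_def)
  qed
  then have "Fraction_Field.Fract (G j - G i) (mon (const_vec n)) \<in> sections (curve_ideal a) t (X i * X j)"
    for i j by (rule sections_XXI)
  then have "s i j \<in> sections (curve_ideal a) t (X i * X j)" for i j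
    by (simp only: s G(1) Fract_diff_same[OF mon_neq_0])
  then show "s \<in> cech_cocycles1 (curve_ideal a) t" unfolding cech_cocycles1_def s by simp
qed

section \<open>The first cohomology\<close>

text \<open>The exponents at which the lines \<open>p\<close> and \<open>q\<close>, and only these, are violated.\<close>

definition obstruction :: "(nat \<Rightarrow> nat) \<Rightarrow> nat \<Rightarrow> nat \<Rightarrow> (coord \<Rightarrow>\<^sub>0 nat) \<Rightarrow> bool" where
  "obstruction a p q \<alpha> \<longleftrightarrow>
     wt (line_vars p) \<alpha> < a p \<and> wt (line_vars q) \<alpha> < a q \<and>
     (\<forall>i\<in>line_indices. i \<noteq> p \<longrightarrow> i \<noteq> q \<longrightarrow> a i \<le> wt (line_vars i) \<alpha>)"

text \<open>Every variable belongs to exactly one of the lines \<open>p\<close> and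
  \<open>q\<close>, so inverting a single variable leaves the other line violated. Hence no section
  over a \<open>basic_open (X i)\<close> has a term at \<open>\<alpha>\<close>, while some cocycle
  does.\<close>

lemma not_ACM_if_obstruction:
  assumes pq: "p \<in> line_indices" "q \<in> line_indices" "line_vars q = - line_vars p"
    and obs: "obstruction a p q \<alpha>"
  shows "\<not> arithmetically_Cohen_Macaulay (curve_ideal a :: 'k::field mpoly4 set)"
proof
  assume ACM: "arithmetically_Cohen_Macaulay (curve_ideal a :: 'k mpoly4 set)"
  define t where "t = int (wt UNIV \<alpha>)"
  define \<phi> :: "coord \<Rightarrow> 'k" where "\<phi> i = (if i \<in> line_vars q then 1 else 0)" for i
  \<comment> \<open>Formally the coboundary of \<open>\<phi> i * x^\<alpha>\<close>, but \<open>x^\<alpha>\<close> is not a section over any \<open>basic_open (X i)\<close>.\<close>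
  define s where "s i j = Fraction_Field.Fract (single \<alpha> (\<phi> j - \<phi> i)) 1" for i j
  have "local_numerator a t {i, j} 0 (single \<alpha> (\<phi> j - \<phi> i))" for i j
  proof -
    \<comment> \<open>The numerator is nonzero only if \<open>\<phi>\<close> differs at
      \<open>i\<close> and \<open>j\<close>; then each of the two complementary edges contains one
      of them, and inverting both lifts both violated conditions.\<close>
    have "l \<notin> {p, q}" if "line_vars l \<inter> {i, j} = {}" "\<phi> i \<noteq> \<phi> j" for l
      using that pq by (auto simp: \<phi>_def split: if_splits)
    then show ?thesis
      using obs by (auto simp: local_numerator_def admissible_def obstruction_def t_def)
  qed
  then have sec: "s i j \<in> sections (curve_ideal a) t (X i * X j)" for i j
    unfolding s_def using sections_XXI[of a t i j 0 "single \<alpha> (\<phi> j - \<phi> i)"] by simp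
  have "s j k - s i k + s i j = 0" for i j k
    unfolding s_def
    by (simp add: Fract_diff_same Fract_add_same Fract_same_eq_0_iff
        flip: single_diff single_add del: diff_fract add_fract)
  with sec have "s \<in> cech_cocycles1 (curve_ideal a) t"
    by (simp add: cech_cocycles1_def)
  then have "s \<in> cech_coboundaries1 (curve_ideal a) t"
    using ACM by (simp add: arithmetically_Cohen_Macaulay_def H1_vanishes_def)
  then obtain r where s: "s = (\<lambda>i j. r j - r i)"
    and r: "\<forall>i. r i \<in> sections (curve_ideal a :: 'k mpoly4 set) t (X i)"
    by (auto simp: cech_coboundaries1_def)
  obtain n G where G: "\<And>i. r i = Fraction_Field.Fract (G i) (mon (const_vec n))"
    "\<And>i. local_numerator a t {i} n (G i)"
    by (rule sections_XD[OF r]) (rule that)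
  \<comment> \<open>Over the common denominator, the exponent \<open>\<alpha>\<close> is represented
    by \<open>\<alpha> + const_vec n\<close>.\<close>
  have zero: "lookup (G i) (\<alpha> + const_vec n) = 0" for i
  proof (rule ccontr)
    assume "lookup (G i) (\<alpha> + const_vec n) \<noteq> 0"
    then have "admissible a n {i} (\<alpha> + const_vec n)"
      using G(2)[of i] by (simp add: local_numerator_def in_keys_iff)
    then have "a l \<le> wt (line_vars l) \<alpha>" if "l \<in> line_indices" "i \<notin> line_vars l" for l
      using that by (auto simp: admissible_def wt_const_vec)
    then show False using obs pq by (cases "i \<in> line_vars p") (fastforce simp: obstruction_def)+
  qed
  have "line_vars p \<noteq> {}" "line_vars q \<noteq> {}" by (simp_all add: line_vars_def)
  then obtain x y where xy: "x \<in> line_vars p" "y \<in> line_vars q" by blast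
  \<comment> \<open>Between these two vertices \<open>\<phi>\<close> jumps from 0 to 1, so
    \<open>s x y\<close> is the monomial itself.\<close>
  have "Fraction_Field.Fract (mon \<alpha>) 1 = Fraction_Field.Fract (G y - G x) (mon (const_vec n) :: 'k mpoly4)"
    using xy pq fun_cong[OF fun_cong[OF s], of x y]
    by (simp add: G Fract_diff_same s_def \<phi>_def del: diff_fract)
  then have "mon (\<alpha> + const_vec n) = G y - G x"
    by (simp add: eq_fract(1) mult_single)
  then show False
    using zero[of x] zero[of y] by (metis lookup_single_eq lookup_minus diff_zero zero_neq_one)
qed

text \<open>Passes from the exponent of a numerator back to that of the fraction; each line has two
  variables, hence the shift by \<open>2 * n\<close>.\<close>

lemma obstruction_shift:
  assumes "\<And>k. n \<le> lookup \<beta> k" "p \<in> line_indices" "q \<in> line_indices"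
    and "wt (line_vars p) \<beta> < a p + 2 * n" "wt (line_vars q) \<beta> < a q + 2 * n"
    and "\<And>i. i \<in> line_indices \<Longrightarrow> i \<noteq> p \<Longrightarrow> i \<noteq> q \<Longrightarrow> a i + 2 * n \<le> wt (line_vars i) \<beta>"
  shows "obstruction a p q (\<beta> - const_vec n)"
proof -
  have \<beta>: "\<beta> - const_vec n + const_vec n = \<beta>"
    by (rule exponent_decomp) (simp add: assms)
  have "wt (line_vars i) \<beta> = wt (line_vars i) (\<beta> - const_vec n) + 2 * n" for i
    using wt_add[of "line_vars i" "\<beta> - const_vec n" "const_vec n"] by (simp add: \<beta> wt_const_vec)
  with assms(4-) show ?thesis by (auto simp: obstruction_def)
qed

lemma all_coord: "(\<forall>k::coord. P k) \<longleftrightarrow> P CA \<and> P CB \<and> P CC \<and> P CD"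
  by (metis coord.exhaust)

lemma ex_coord: "(\<exists>k::coord. P k) \<longleftrightarrow> P CA \<or> P CB \<or> P CC \<or> P CD"
  by (metis coord.exhaust)

text \<open>
  If \<open>w\<close> is as below, then \<open>i \<mapsto> s w i\<close> is a cochain of sections whose coboundary is \<open>s\<close>. Only the
  vanishing pattern of the cocycle matters: if two entries on a triangle vanish, so does the third.
\<close>

lemma ex_base_vertex:
  fixes s :: "coord \<Rightarrow> coord \<Rightarrow> 'k::field"
  assumes cocycle: "\<And>i j k. s j k - s i k + s i j = 0"
    and adm: "\<And>i j. s i j \<noteq> 0 \<Longrightarrow> admissible a n {i, j} \<beta>"
    and no_obs: "\<And>\<alpha>. \<not> obstruction a 1 6 \<alpha>" "\<And>\<alpha>. \<not> obstruction a 3 4 \<alpha>"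
  shows "\<exists>w. \<forall>i. s w i \<noteq> 0 \<longrightarrow> admissible a n {i} \<beta>"
proof -
  \<comment> \<open>\<open>pos k\<close> says that the exponent of the fraction at \<open>k\<close>
    is nonnegative, \<open>sat i\<close> that line \<open>i\<close> is not violated. The rest is
    propositional in these and in the zeros of \<open>s\<close>.\<close>
  define pos where "pos k \<longleftrightarrow> n \<le> lookup \<beta> k" for k
  define sat where "sat i \<longleftrightarrow> a i + 2 * n \<le> wt (line_vars i) \<beta>" for i
  have adm_iff: "admissible a n F \<beta> \<longleftrightarrow>
      (\<forall>k. k \<notin> F \<longrightarrow> pos k) \<and> (\<forall>i\<in>line_indices. line_vars i \<inter> F = {} \<longrightarrow> sat i)" for F
    by (simp add: admissible_def pos_def sat_def)
  have "\<not> ((\<forall>k. pos k) \<and> \<not> sat p \<and> \<not> sat q \<and> 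
      (\<forall>i\<in>line_indices. i \<noteq> p \<longrightarrow> i \<noteq> q \<longrightarrow> sat i))"
    if "p \<in> line_indices" "q \<in> line_indices" "\<And>\<alpha>. \<not> obstruction a p q \<alpha>" for p q
    using obstruction_shift[OF _ that(1,2), of n \<beta> a] that(3)
    unfolding pos_def sat_def not_le by metis
  from this[of 1 6] this[of 3 4] no_obs
  have "\<not> ((\<forall>k. pos k) \<and> \<not> sat 1 \<and> \<not> sat 6 \<and> sat 3 \<and> sat 4)"
    "\<not> ((\<forall>k. pos k) \<and> sat 1 \<and> sat 6 \<and> \<not> sat 3 \<and> \<not> sat 4)"
    by (auto simp: line_indices_def)
  note no_skew_pair = this
  have diag: "s i i = 0" for i using cocycle[of i i i] by simp
  have sym: "s j i = 0 \<longleftrightarrow> s i j = 0" for i j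
    using cocycle[of j i i] diag[of i] by (auto simp: add_eq_0_iff)
  have tri: "s i j = 0 \<longrightarrow> s j k = 0 \<longrightarrow> s i k = 0" for i j k
    using cocycle[of j k i] by auto
  \<comment> \<open>The zeros of \<open>s\<close> form an equivalence relation on the vertices. If
    \<open>pos k\<close> fails, the other three vertices are equivalent. If all \<open>pos\<close>
    hold, a violated edge makes the endpoints of the opposite edge equivalent; with the skew pairs
    excluded, the violated edges are none, one, two adjacent ones or at least three. Each time a
    vertex of the class so obtained (any vertex if there is no violated edge) serves as
    \<open>w\<close>.\<close>
  note no_skew_pair
  moreover have "s CA CB \<noteq> 0 \<longrightarrow> pos CC \<and> pos CD \<and> sat 6" "s CA CC \<noteq> 0 \<longrightarrow> pos CB \<and> pos CD"
    "s CA CD \<noteq> 0 \<longrightarrow> pos CB \<and> pos CC \<and> sat 4" "s CB CC \<noteq> 0 \<longrightarrow> pos CA \<and> pos CD \<and> sat 3"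
    "s CB CD \<noteq> 0 \<longrightarrow> pos CA \<and> pos CC" "s CC CD \<noteq> 0 \<longrightarrow> pos CA \<and> pos CB \<and> sat 1"
    using adm[unfolded adm_iff] by (auto simp: line_indices_def)
  moreover have "admissible a n {CA} \<beta> \<longleftrightarrow> pos CB \<and> pos CC \<and> pos CD \<and> sat 4 \<and> sat 6"
    "admissible a n {CB} \<beta> \<longleftrightarrow> pos CA \<and> pos CC \<and> pos CD \<and> sat 3 \<and> sat 6"
    "admissible a n {CC} \<beta> \<longleftrightarrow> pos CA \<and> pos CB \<and> pos CD \<and> sat 1 \<and> sat 3"
    "admissible a n {CD} \<beta> \<longleftrightarrow> pos CA \<and> pos CB \<and> pos CC \<and> sat 1 \<and> sat 4"
    unfolding adm_iff all_coord by (auto simp: line_indices_def)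
  moreover note tri[of CA CB CC] tri[of CA CC CB] tri[of CB CA CC]
    tri[of CA CB CD] tri[of CA CD CB] tri[of CB CA CD]
    tri[of CA CC CD] tri[of CA CD CC] tri[of CC CA CD]
    tri[of CB CC CD] tri[of CB CD CC] tri[of CC CB CD]
    sym[of CA CB] sym[of CA CC] sym[of CA CD] sym[of CB CC] sym[of CB CD] sym[of CC CD]
    diag[of CA] diag[of CB] diag[of CC] diag[of CD]
  ultimately show ?thesis
    unfolding all_coord ex_coord by argo
qed

text \<open>The base vertex may vary with the exponent: the terms taken from
  \<open>G (w \<beta>) i\<close> at each \<open>\<beta>\<close> are assembled into one numerator
  \<open>R i\<close>, and the cocycle identity gives \<open>R j - R i = G i j\<close>.\<close>

lemma ACM_if_no_obstruction:
  assumes no_obs: "\<And>\<alpha>. \<not> obstruction a 1 6 \<alpha>" "\<And>\<alpha>. \<not> obstruction a 3 4 \<alpha>"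
  shows "arithmetically_Cohen_Macaulay (curve_ideal a :: 'k::field mpoly4 set)"
  unfolding arithmetically_Cohen_Macaulay_def H1_vanishes_def
proof (intro allI equalityI coboundaries_subset_cocycles subsetI)
  fix t s
  assume "s \<in> cech_cocycles1 (curve_ideal a :: 'k mpoly4 set) t"
  then have sec: "\<forall>i j. s i j \<in> sections (curve_ideal a :: 'k mpoly4 set) t (X i * X j)"
    and coc: "\<And>i j k. s j k - s i k + s i j = 0"
    by (auto simp: cech_cocycles1_def)
  obtain n G where G: "\<And>i j. s i j = Fraction_Field.Fract (G i j) (mon (const_vec n))"
    "\<And>i j. local_numerator a t {i, j} n (G i j)"
    by (rule sections_XXD[OF sec]) (rule that)
  have "G j k - G i k + G i j = 0" for i j k
    using coc[where i = i and j = j and k = k]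
    by (simp add: G Fract_diff_same Fract_add_same Fract_same_eq_0_iff del: diff_fract add_fract)
  then have cocycle: "lookup (G j k) \<beta> - lookup (G i k) \<beta> + lookup (G i j) \<beta> = 0" for i j k \<beta>
    by (metis lookup_add lookup_minus lookup_zero)
  have "\<exists>w. \<forall>i. lookup (G w i) \<beta> \<noteq> 0 \<longrightarrow> admissible a n {i} \<beta>" for \<beta>
  proof (rule ex_base_vertex[where s = "\<lambda>i j. lookup (G i j) \<beta>", OF cocycle _ no_obs])
    fix i j
    show "lookup (G i j) \<beta> \<noteq> 0 \<Longrightarrow> admissible a n {i, j} \<beta>"
      using G(2)[of i j] by (simp add: local_numerator_def in_keys_iff)
  qed
  then obtain w where w: "\<And>\<beta> i. lookup (G (w \<beta>) i) \<beta> \<noteq> 0 \<Longrightarrow> admissible a n {i} \<beta>"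
    by metis
  \<comment> \<open>All coefficients vanish outside this finite set, so the finite sum
    \<open>R i\<close> misses no term.\<close>
  define K where "K = (\<Union>i. \<Union>j. keys (G i j))"
  define R where "R i = (\<Sum>\<beta>\<in>K. single \<beta> (lookup (G (w \<beta>) i) \<beta>))" for i
  have "finite K" by (simp add: K_def)
  then have lookup_R: "lookup (R i) \<beta> = lookup (G (w \<beta>) i) \<beta>" for i \<beta>
    by (auto simp: R_def lookup_sum lookup_single when_def sum.delta K_def in_keys_iff)
  have "local_numerator a t {i} n (R i)" for i
    unfolding local_numerator_def
  proof
    fix \<beta> assume "\<beta> \<in> keys (R i)"
    then have "lookup (G (w \<beta>) i) \<beta> \<noteq> 0" by (simp add: in_keys_iff lookup_R)
    then show "int (wt UNIV \<beta>) = t + 4 * int n \<and> admissible a n {i} \<beta>"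
      using w G(2)[of "w \<beta>" i] by (auto simp: local_numerator_def in_keys_iff)
  qed
  then have "\<forall>i. Fraction_Field.Fract (R i) (mon (const_vec n)) \<in> sections (curve_ideal a) t (X i)"
    by (simp add: sections_XI)
  moreover have "G i j = R j - R i" for i j
  proof (rule poly_mapping_eqI)
    fix \<beta> show "lookup (G i j) \<beta> = lookup (R j - R i) \<beta>"
      using cocycle[of i j \<beta> "w \<beta>"] by (simp add: lookup_minus lookup_R algebra_simps)
  qed
  then have "s = (\<lambda>i j. Fraction_Field.Fract (R j) (mon (const_vec n)) - Fraction_Field.Fract (R i) (mon (const_vec n)))"
    by (intro ext) (simp add: G Fract_diff_same del: diff_fract)
  ultimately show "s \<in> cech_coboundaries1 (curve_ideal a) t"
    unfolding cech_coboundaries1_def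
    by (intro CollectI exI[of _ "\<lambda>i. Fraction_Field.Fract (R i) (mon (const_vec n))"]) simp
qed

section \<open>Numerical form of the obstruction\<close>

text \<open>The letters label the vertices of a 4-cycle. Either pair of opposite edges covers each
  vertex once, so adding the inequalities gives necessity.\<close>

lemma ex_quadrilateral_labels:
  fixes p q p' q' :: nat
  shows "(\<exists>x y z w. x + y < p \<and> z + w < q \<and> p' \<le> x + w \<and> q' \<le> y + z) \<longleftrightarrow>
    0 < p \<and> 0 < q \<and> p' + q' + 2 \<le> p + q" (is "?L \<longleftrightarrow> ?R")
proof
  assume ?R
  \<comment> \<open>Both strict bounds are exhausted: \<open>x + y = p - 1\<close> and
    \<open>z + w = q - 1\<close>. With \<open>x\<close> as close to \<open>p'\<close> as allowed,
    \<open>w = p' - x\<close> stays within \<open>q - 1\<close>.\<close>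
  define x where "x = min p' (p - 1)"
  have "x + (p - 1 - x) < p" "(q - 1 - (p' - x)) + (p' - x) < q"
    "p' \<le> x + (p' - x)" "q' \<le> (p - 1 - x) + (q - 1 - (p' - x))"
    using \<open>?R\<close> by (auto simp: x_def min_def)
  then show ?L by blast
qed auto

lemma ex_exponent_iff:
  "(\<exists>\<alpha>. P (lookup \<alpha> CA) (lookup \<alpha> CB) (lookup \<alpha> CC) (lookup \<alpha> CD)) \<longleftrightarrow>
     (\<exists>x y z w :: nat. P x y z w)"
proof
  assume "\<exists>x y z w. P x y z w"
  then obtain x y z w where "P x y z w" by blast
  then show "\<exists>\<alpha>. P (lookup \<alpha> CA) (lookup \<alpha> CB) (lookup \<alpha> CC) (lookup \<alpha> CD)"
    by (intro exI[of _ "expvec (case_coord x y z w)"]) simp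
qed blast

lemma ex_obstruction_1_6_iff:
  "(\<exists>\<alpha>. obstruction a 1 6 \<alpha>) \<longleftrightarrow> 0 < a 1 \<and> 0 < a 6 \<and> a 3 + a 4 + 2 \<le> a 1 + a 6"
proof -
  have "obstruction a 1 6 \<alpha> \<longleftrightarrow> lookup \<alpha> CA + lookup \<alpha> CB < a 1 \<and> lookup \<alpha> CC + lookup \<alpha> CD < a 6 \<and>
      a 3 \<le> lookup \<alpha> CA + lookup \<alpha> CD \<and> a 4 \<le> lookup \<alpha> CB + lookup \<alpha> CC" for \<alpha>
    by (auto simp: obstruction_def line_indices_def wt_def)
  then show ?thesis
    using ex_exponent_iff[of "\<lambda>x y z w. x + y < a 1 \<and> z + w < a 6 \<and> a 3 \<le> x + w \<and> a 4 \<le> y + z"]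
    by (simp only: ex_quadrilateral_labels)
qed

lemma ex_obstruction_3_4_iff:
  "(\<exists>\<alpha>. obstruction a 3 4 \<alpha>) \<longleftrightarrow> 0 < a 3 \<and> 0 < a 4 \<and> a 1 + a 6 + 2 \<le> a 3 + a 4"
proof -
  have "obstruction a 3 4 \<alpha> \<longleftrightarrow> lookup \<alpha> CA + lookup \<alpha> CD < a 3 \<and> lookup \<alpha> CC + lookup \<alpha> CB < a 4 \<and>
      a 1 \<le> lookup \<alpha> CA + lookup \<alpha> CB \<and> a 6 \<le> lookup \<alpha> CD + lookup \<alpha> CC" for \<alpha>
    by (auto simp: obstruction_def line_indices_def wt_def)
  \<comment> \<open>The cycle is read in the other direction: \<open>CB\<close> now carries the
    label \<open>w\<close> and \<open>CD\<close> the label \<open>y\<close>.\<close>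
  then have "(\<exists>\<alpha>. obstruction a 3 4 \<alpha>) \<longleftrightarrow> (\<exists>x w z y. x + y < a 3 \<and> z + w < a 4 \<and> a 1 \<le> x + w \<and> a 6 \<le> y + z)"
    using ex_exponent_iff[of "\<lambda>x w z y. x + y < a 3 \<and> z + w < a 4 \<and> a 1 \<le> x + w \<and> a 6 \<le> y + z"]
    by simp
  also have "\<dots> \<longleftrightarrow> (\<exists>x y z w. x + y < a 3 \<and> z + w < a 4 \<and> a 1 \<le> x + w \<and> a 6 \<le> y + z)"
    by blast
  finally show ?thesis by (simp only: ex_quadrilateral_labels)
qed

lemma ACM_iff:
  "arithmetically_Cohen_Macaulay (curve_ideal a :: 'k::field mpoly4 set) \<longleftrightarrow>
     \<not> (0 < a 1 \<and> 0 < a 6 \<and> a 3 + a 4 + 2 \<le> a 1 + a 6) \<and>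
     \<not> (0 < a 3 \<and> 0 < a 4 \<and> a 1 + a 6 + 2 \<le> a 3 + a 4)"
proof -
  have "line_vars 6 = - line_vars 1" "line_vars 4 = - line_vars 3"
    using UNIV_coord by auto
  then have "arithmetically_Cohen_Macaulay (curve_ideal a :: 'k::field mpoly4 set) \<longleftrightarrow>
      \<not> (\<exists>\<alpha>. obstruction a 1 6 \<alpha>) \<and> \<not> (\<exists>\<alpha>. obstruction a 3 4 \<alpha>)"
    using ACM_if_no_obstruction not_ACM_if_obstruction[of 1 6] not_ACM_if_obstruction[of 3 4]
    unfolding line_indices_def by blast
  then show ?thesis
    by (simp only: ex_obstruction_1_6_iff ex_obstruction_3_4_iff)
qed

section \<open>The Zariski topology on the support\<close>

lemma X_in_span_vars_iff: "(X j :: 'k::field mpoly4) \<in> ideal.span (X ` S) \<longleftrightarrow> j \<in> S"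
  unfolding span_vars_eq by (simp add: X_def)

text \<open>Modulo the ideal, each polynomial equals one free of the variables in \<open>S\<close>.
  A product of two such polynomials is again free of them, so it lies in the ideal only if it is
  zero, and the polynomial ring is a domain.\<close>

lemma prime_ideal_span_vars:
  "prime_ideal (ideal.span (X ` S) :: 'k::field mpoly4 set)"
  unfolding prime_ideal_def
proof (intro conjI allI impI ideal.subspace_span)
  let ?P = "ideal.span (X ` S) :: 'k mpoly4 set"
  show "?P \<noteq> UNIV"
  proof
    assume "?P = UNIV"
    then have "1 \<in> ?P" by simp
    then show False by (simp add: span_vars_eq)
  qed
  have split: "\<exists>f'. f - f' \<in> ?P \<and> (\<forall>m\<in>keys f'. wt S m = 0)" for f
  proof -
    define f' where "f' = (\<Sum>m\<in>{m\<in>keys f. wt S m = 0}. single m (lookup f m))"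
    have "lookup f' n = (if wt S n = 0 then lookup f n else 0)" for n
      by (auto simp: f'_def lookup_sum lookup_single when_def sum.delta in_keys_iff)
    then show ?thesis
      by (intro exI[of _ f']) (auto simp: span_vars_eq in_keys_iff lookup_minus split: if_splits)
  qed
  fix x y assume xy: "x * y \<in> ?P"
  obtain x' where x': "x - x' \<in> ?P" "\<forall>m\<in>keys x'. wt S m = 0" using split by blast
  obtain y' where y': "y - y' \<in> ?P" "\<forall>m\<in>keys y'. wt S m = 0" using split by blast
  have "x' * y' = x * y - y * (x - x') - x' * (y - y')" by (simp add: algebra_simps)
  then have "x' * y' \<in> ?P" using xy x' y' by (simp add: ideal.span_diff ideal.span_scale)
  moreover have "\<forall>m\<in>keys (x' * y'). wt S m = 0"
    using keys_mult[of x' y'] x' y' by fastforce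
  ultimately have "keys (x' * y') = {}" by (auto simp: span_vars_eq)
  then have "x' * y' = 0" by (metis empty_iff in_keys_iff lookup_zero poly_mapping_eqI)
  then show "x \<in> ?P \<or> y \<in> ?P" using x' y' by auto
qed

lemma span_vars_in_proj_points:
  assumes "S \<noteq> UNIV"
  shows "(ideal.span (X ` S) :: 'k::field mpoly4 set) \<in> proj_points"
proof -
  have "homogeneous_ideal (ideal.span (X ` S) :: 'k mpoly4 set)"
    unfolding homogeneous_ideal_def
    by (intro exI[of _ "X ` S"]) (auto simp: homogeneous_iff_wt X_def)
  moreover obtain j where "j \<notin> S" using assms by auto
  then have "\<not> ideal.span (range X) \<subseteq> (ideal.span (X ` S) :: 'k mpoly4 set)"
    using X_in_span_vars_iff[of j S] by (auto dest: subsetD[OF _ ideal.span_base[OF rangeI[of X j]]])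
  ultimately show ?thesis by (simp add: proj_points_def prime_ideal_span_vars)
qed

lemma span_vars_in_V_iff:
  assumes "S \<noteq> UNIV"
  shows "(ideal.span (X ` S) :: 'k::field mpoly4 set) \<in> V (X ` T) \<longleftrightarrow> T \<subseteq> S"
  using span_vars_in_proj_points[OF assms] by (auto simp: V_def X_in_span_vars_iff)

lemma proj_point_not_all_vars:
  assumes "P \<in> proj_points"
  obtains j where "X j \<notin> P"
proof -
  have "ideal.subspace P" "\<not> ideal.span (range X) \<subseteq> P"
    using assms by (auto simp: proj_points_def prime_ideal_def)
  then show thesis using that ideal.span_minimal[of "range X" P] by blast
qed

text \<open>The prime generated by the variables in \<open>S \<union> T\<close> is a common point,
  unless it is the irrelevant ideal, which no point contains.\<close>

lemma V_vars_Int_empty_iff: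
  "(V (X ` S) \<inter> V (X ` T) :: 'k::field mpoly4 set set) = {} \<longleftrightarrow> S \<union> T = UNIV"
proof
  assume "(V (X ` S) \<inter> V (X ` T) :: 'k mpoly4 set set) = {}"
  then show "S \<union> T = UNIV"
    using span_vars_in_V_iff[of "S \<union> T" S, where ?'k = 'k]
      span_vars_in_V_iff[of "S \<union> T" T, where ?'k = 'k] by blast
next
  assume "S \<union> T = UNIV"
  then show "(V (X ` S) \<inter> V (X ` T) :: 'k mpoly4 set set) = {}"
    by (auto simp: V_def elim!: proj_point_not_all_vars) blast
qed

text \<open>The basic open set of the constant 1 already contains all points.\<close>

lemma topspace_zariski: "topspace (zariski :: 'k::field mpoly4 set topology) = proj_points"
proof -
  have "basic_open 1 = (proj_points :: 'k mpoly4 set set)"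
  proof -
    have "1 \<notin> P" if "P \<in> proj_points" for P :: "'k mpoly4 set"
    proof
      assume "1 \<in> P"
      moreover have P: "ideal.subspace P" "P \<noteq> UNIV"
        using that by (auto simp: proj_points_def prime_ideal_def)
      ultimately have "x * 1 \<in> P" for x by (intro ideal.subspace_scale) auto
      then show False using P by auto
    qed
    then show ?thesis by (auto simp: basic_open_def)
  qed
  moreover have "homogeneous 0 (1 :: 'k mpoly4)" by (simp add: homogeneous_iff_wt)
  ultimately show ?thesis
    unfolding zariski_def topology_generated_by_topspace by (auto simp: basic_open_def)
qed

text \<open>A basic open set contains with a prime every smaller point, and this survives
  intersections and unions.\<close>

lemma openin_zariski_generization:
  assumes "openin zariski U" "Q \<in> U" "P \<subseteq> Q" "P \<in> proj_points"
  shows "P \<in> U"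
proof -
  have "generate_topology_on {basic_open f | f. \<exists>d. homogeneous d f} U"
    using assms(1) by (simp add: zariski_def openin_topology_generated_by)
  then show ?thesis using assms(2-4)
    by (induction arbitrary: Q) (auto simp: basic_open_def)
qed

lemma closedin_V_vars: "closedin zariski (V (X ` S) :: 'k::field mpoly4 set set)"
proof -
  have "openin zariski (basic_open (X j :: 'k mpoly4))" for j
    unfolding zariski_def
    by (rule topology_generated_by_Basis) (auto simp: homogeneous_iff_wt X_def)
  moreover have "proj_points - V (X ` S) = (\<Union>j\<in>S. basic_open (X j :: 'k mpoly4))"
    by (auto simp: V_def basic_open_def)
  ultimately have "openin zariski (proj_points - V (X ` S) :: 'k mpoly4 set set)" by auto
  then show ?thesis
    unfolding closedin_def topspace_zariski by (auto simp: V_def)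
qed

text \<open>Every open set meeting the linear subspace contains its generic point \<open>?P\<close>,
  so two such open sets always meet inside it.\<close>

lemma connectedin_V_vars:
  assumes "S \<noteq> UNIV"
  shows "connectedin zariski (V (X ` S) :: 'k::field mpoly4 set set)"
proof -
  let ?P = "ideal.span (X ` S) :: 'k mpoly4 set"
  have gen: "?P \<in> U" if U: "openin zariski U" "U \<inter> V (X ` S) \<noteq> {}" for U
  proof -
    obtain Q where Q: "Q \<in> U" "Q \<in> V (X ` S)" using U(2) by blast
    then have "?P \<subseteq> Q"
      by (intro ideal.span_minimal) (auto simp: V_def proj_points_def prime_ideal_def)
    then show ?thesis
      using openin_zariski_generization[OF U(1) Q(1)] span_vars_in_proj_points[OF assms] by blast
  qed
  have "?P \<in> V (X ` S)" using span_vars_in_V_iff[OF assms] by blast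
  moreover have "V (X ` S) \<subseteq> topspace (zariski :: 'k mpoly4 set topology)"
    by (auto simp: topspace_zariski V_def)
  ultimately show ?thesis unfolding connectedin using gen by blast
qed

section \<open>The support of the curve and its connectedness\<close>

lemma power_in_ideal_power: "x \<in> I \<Longrightarrow> x ^ n \<in> ideal_power I n"
  by (induction n) (auto simp: ideal_mult_def intro!: ideal.span_base)

lemma prime_ideal_prodD:
  assumes "prime_ideal P" "finite A" "prod f A \<in> P"
  shows "\<exists>i\<in>A. f i \<in> P"
  using assms(2,3)
proof (induction A rule: finite_induct)
  case empty
  then have "ideal.subspace P" "P \<noteq> UNIV" "1 \<in> P" using assms(1) by (auto simp: prime_ideal_def)
  then show ?case using ideal.subspace_scale[of P 1] by auto
next
  case (insert i A)
  then show ?case using assms(1) by (auto simp: prime_ideal_def)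
qed

lemma prime_ideal_powerD: "prime_ideal P \<Longrightarrow> x ^ n \<in> P \<Longrightarrow> 0 < n \<and> x \<in> P"
  using prime_ideal_prodD[of P "{..<n}" "\<lambda>_. x"] by auto

text \<open>A prime missing a linear form of each line of positive weight would miss the product of
  their \<open>a i\<close>-th powers, which lies in the curve ideal.\<close>

lemma V_curve_ideal:
  "V (curve_ideal a :: 'k::field mpoly4 set) = (\<Union>i\<in>{i \<in> line_indices. 0 < a i}. V (line_forms i))"
proof (intro equalityI subsetI)
  fix P assume P: "P \<in> V (curve_ideal a :: 'k mpoly4 set)"
  then have prime: "prime_ideal P" by (auto simp: V_def proj_points_def)
  show "P \<in> (\<Union>i\<in>{i \<in> line_indices. 0 < a i}. V (line_forms i))"
  proof (rule ccontr)
    assume contr: "P \<notin> (\<Union>i\<in>{i \<in> line_indices. 0 < a i}. V (line_forms i))"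
    \<comment> \<open>For a line of weight zero any form will do, as its zeroth power is 1.\<close>
    have "\<exists>x\<in>line_forms i. 0 < a i \<longrightarrow> x \<notin> P" if "i \<in> line_indices" for i
    proof (cases "0 < a i")
      case True
      then show ?thesis using contr that P by (auto simp: V_def)
    qed (auto simp: line_forms_def)
    then obtain x where x: "\<And>i. i \<in> line_indices \<Longrightarrow> x i \<in> line_forms i \<and> (0 < a i \<longrightarrow> x i \<notin> P)"
      by metis
    have "(\<Prod>i\<in>line_indices. x i ^ a i) \<in> curve_ideal a"
      unfolding curve_ideal_def
    proof
      fix i assume i: "i \<in> line_indices"
      then have "x i ^ a i \<in> ideal_power (ideal.span (line_forms i)) (a i)"
        by (intro power_in_ideal_power ideal.span_base) (use x in blast)
      then have "(\<Prod>j\<in>line_indices - {i}. x j ^ a j) * x i ^ a i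
          \<in> ideal_power (ideal.span (line_forms i)) (a i)"
        by (rule ideal.subspace_scale[OF subspace_ideal_power])
      then show "(\<Prod>i\<in>line_indices. x i ^ a i) \<in> ideal_power (ideal.span (line_forms i)) (a i)"
        using i by (subst prod.remove[of _ i]) (auto simp: line_indices_def mult.commute)
    qed
    then have "(\<Prod>i\<in>line_indices. x i ^ a i) \<in> P" using P by (auto simp: V_def)
    then obtain i where "i \<in> line_indices" "x i ^ a i \<in> P"
      using prime_ideal_prodD[OF prime, of line_indices "\<lambda>i. x i ^ a i"]
      by (auto simp: line_indices_def)
    then show False using prime_ideal_powerD[OF prime, of "x i" "a i"] x by blast
  qed
next
  fix P assume "P \<in> (\<Union>i\<in>{i \<in> line_indices. 0 < a i}. V (line_forms i :: 'k mpoly4 set))"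
  then obtain i where i: "i \<in> line_indices" "0 < a i" "P \<in> V (line_forms i)" by blast
  then have "ideal.span (line_forms i) \<subseteq> P"
    by (intro ideal.span_minimal) (auto simp: V_def proj_points_def prime_ideal_def)
  moreover have "curve_ideal a \<subseteq> (ideal.span (line_forms i) :: 'k mpoly4 set)"
    using i by (fastforce simp: mem_curve_ideal_iff line_forms_eq span_vars_eq)
  ultimately show "P \<in> V (curve_ideal a)" using i by (auto simp: V_def)
qed

text \<open>The two pieces are closed, disjoint, and nonempty because of their generic
  points.\<close>

lemma disconnected_V_vars_Un:
  assumes "S \<union> T = UNIV" "S \<noteq> UNIV" "T \<noteq> UNIV"
  shows "\<not> connectedin zariski (V (X ` S) \<union> V (X ` T) :: 'k::field mpoly4 set set)"
proof -
  have "V (X ` S) \<noteq> ({} :: 'k mpoly4 set set)" "V (X ` T) \<noteq> ({} :: 'k mpoly4 set set)"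
    using span_vars_in_V_iff[OF assms(2), of S] span_vars_in_V_iff[OF assms(3), of T] by blast+
  moreover have "V (X ` S) \<inter> V (X ` T) = ({} :: 'k mpoly4 set set)"
    using assms(1) by (simp add: V_vars_Int_empty_iff)
  ultimately show ?thesis
    unfolding connectedin_closedin
    using closedin_V_vars[of S, where ?'k = 'k] closedin_V_vars[of T, where ?'k = 'k] by blast
qed

lemma connectedin_V_vars_Un:
  assumes "S \<union> T \<noteq> UNIV"
  shows "connectedin zariski (V (X ` S) \<union> V (X ` T) :: 'k::field mpoly4 set set)"
  using assms V_vars_Int_empty_iff[of S T, where ?'k = 'k]
  by (intro connectedin_Un connectedin_V_vars) auto

text \<open>Two of the lines meet exactly if some variable is missing from both forms sets, that is,
  if their edges share a vertex.\<close>

lemma lines_meeting_simps: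
  "lines_meeting TYPE('k::field) 1 = {3, 4}" "lines_meeting TYPE('k) 6 = {3, 4}"
  "lines_meeting TYPE('k) 3 = {1, 6}" "lines_meeting TYPE('k) 4 = {1, 6}"
proof -
  have *: "lines_meeting TYPE('k) i = {j \<in> line_indices. j \<noteq> i \<and> line_vars i \<union> line_vars j \<noteq> UNIV}" for i
    by (simp add: lines_meeting_def line_forms_eq V_vars_Int_empty_iff)
  show "lines_meeting TYPE('k::field) 1 = {3, 4}" "lines_meeting TYPE('k) 6 = {3, 4}"
    "lines_meeting TYPE('k) 3 = {1, 6}" "lines_meeting TYPE('k) 4 = {1, 6}"
    unfolding * by (auto simp: line_indices_def UNIV_coord)
qed

lemma line_vars_neq_UNIV: "line_vars i \<noteq> UNIV"
  by (auto simp: line_vars_def UNIV_coord)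

lemma finite_line_indices [simp]: "finite line_indices"
  by (simp add: line_indices_def)

lemma card_support_le_2:
  fixes a :: "nat \<Rightarrow> nat"
  assumes "card {j \<in> line_indices. a j = 0} \<ge> 2"
  shows "card {j \<in> line_indices. 0 < a j} \<le> 2"
proof -
  have "line_indices = {j \<in> line_indices. a j = 0} \<union> {j \<in> line_indices. 0 < a j}" by auto
  then have "card line_indices = card {j \<in> line_indices. a j = 0} + card {j \<in> line_indices. 0 < a j}"
    by (metis (mono_tags, lifting) card_Un_disjoint disjoint_iff finite_Un finite_line_indices
        less_numeral_extra(3) mem_Collect_eq)
  then show ?thesis using assms by (simp add: line_indices_def)
qed

text \<open>At most two lines remain, so the support is empty, a line, or two lines; only a skew
  pair is disconnected.\<close>

lemma connectedin_V_curve_ideal_iff: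
  assumes "card {j \<in> line_indices. a j = 0} \<ge> 2"
  shows "connectedin zariski (V (curve_ideal a) :: 'k::field mpoly4 set set) \<longleftrightarrow>
    \<not> (0 < a 1 \<and> 0 < a 6) \<and> \<not> (0 < a 3 \<and> 0 < a 4)"
proof -
  define W where "W = {i \<in> line_indices. 0 < a i}"
  have "V (curve_ideal a) = (\<Union>i\<in>W. V (X ` line_vars i) :: 'k mpoly4 set set)"
    by (simp add: W_def V_curve_ideal line_forms_eq)
  note V_eq = this
  have W_iff: "0 < a i \<longleftrightarrow> i \<in> W" if "i \<in> line_indices" for i
    using that by (simp add: W_def)
  have "card W \<le> 2" using card_support_le_2[OF assms] by (simp add: W_def)
  have "W \<subseteq> line_indices" "finite W" by (auto simp: W_def line_indices_def)
  consider "W = {}" | i where "W = {i}" | i j where "W = {i, j}" "i \<noteq> j"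
    using \<open>card W \<le> 2\<close> \<open>finite W\<close>
    by (metis card_0_eq card_1_singletonE card_2_iff le_Suc_eq numeral_2_eq_2 One_nat_def le_zero_eq)
  then show ?thesis
  proof cases
    case 1
    then show ?thesis by (simp add: V_eq W_iff line_indices_def)
  next
    case (2 i)
    then show ?thesis
      using connectedin_V_vars[OF line_vars_neq_UNIV]
      by (auto simp: V_eq W_iff line_indices_def)
  next
    case (3 i j)
    then have "connectedin zariski (V (curve_ideal a) :: 'k mpoly4 set set) \<longleftrightarrow>
        line_vars i \<union> line_vars j \<noteq> UNIV"
      using disconnected_V_vars_Un[OF _ line_vars_neq_UNIV line_vars_neq_UNIV]
        connectedin_V_vars_Un[of "line_vars i" "line_vars j", where ?'k = 'k]
      by (auto simp: V_eq)
    also have "\<dots> \<longleftrightarrow> \<not> (1 \<in> W \<and> 6 \<in> W) \<and> \<not> (3 \<in> W \<and> 4 \<in> W)"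
    proof -
      have "i = 1 \<or> i = 3 \<or> i = 4 \<or> i = 6" "j = 1 \<or> j = 3 \<or> j = 4 \<or> j = 6"
        using 3(1) \<open>W \<subseteq> line_indices\<close> by (simp_all add: line_indices_def)
      with \<open>i \<noteq> j\<close> show ?thesis
        unfolding 3(1) by (elim disjE) (auto simp: UNIV_coord)
    qed
    finally show ?thesis by (simp add: W_iff line_indices_def)
  qed
qed

section \<open>The three cases of the criterion\<close>

theorem theorem5p3:
  fixes a :: "nat \<Rightarrow> nat"
  defines "C \<equiv> curve_ideal a :: 'k::field mpoly4 set"
  shows
    "((\<forall>i\<in>line_indices. a i > 0) \<longrightarrow>
        (arithmetically_Cohen_Macaulay C \<longleftrightarrow>
          (\<exists>\<epsilon>\<in>{-1, 0, 1}. int (a 1) + int (a 6) = int (a 3) + int (a 4) + \<epsilon>))) \<and>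
     (\<forall>i. {j \<in> line_indices. a j = 0} = {i} \<longrightarrow>
        (arithmetically_Cohen_Macaulay C \<longleftrightarrow>
          a (7 - i) + 1 \<ge> (\<Sum>j\<in>lines_meeting TYPE('k) i. a j))) \<and>
     (card {j \<in> line_indices. a j = 0} \<ge> 2 \<longrightarrow>
        (arithmetically_Cohen_Macaulay C \<longleftrightarrow> connectedin zariski (V C)))"
proof (intro conjI allI impI)
  assume "\<forall>i\<in>line_indices. a i > 0"
  then have "a 1 > 0" "a 3 > 0" "a 4 > 0" "a 6 > 0" by (simp_all add: line_indices_def)
  \<comment> \<open>With all weights positive, excluding both inequalities leaves a difference of at
    most 1 between the two sums.\<close>
  then show "arithmetically_Cohen_Macaulay C \<longleftrightarrow>
      (\<exists>\<epsilon>\<in>{-1, 0, 1}. int (a 1) + int (a 6) = int (a 3) + int (a 4) + \<epsilon>)"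
    unfolding C_def ACM_iff by auto
next
  fix i assume i: "{j \<in> line_indices. a j = 0} = {i}"
  have "i \<in> {j \<in> line_indices. a j = 0}" unfolding i by simp
  then have zero: "a i = 0" and "i \<in> line_indices" by auto
  have pos: "a j > 0" if "j \<in> line_indices" "j \<noteq> i" for j
  proof (rule ccontr)
    assume "\<not> a j > 0"
    then have "j \<in> {j \<in> line_indices. a j = 0}" using that by simp
    then show False using that(2) unfolding i by simp
  qed
  from \<open>i \<in> line_indices\<close> consider "i = 1" | "i = 3" | "i = 4" | "i = 6"
    by (auto simp: line_indices_def)
  \<comment> \<open>The zero weight rules out an obstruction from the skew pair \<open>i\<close>,
    \<open>7 - i\<close>; what remains is the negated inequality for the other pair, whose members
    are the lines meeting \<open>i\<close>.\<close>
  then show "arithmetically_Cohen_Macaulay C \<longleftrightarrow>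
      a (7 - i) + 1 \<ge> (\<Sum>j\<in>lines_meeting TYPE('k) i. a j)"
    by cases (use zero pos[of 1] pos[of 3] pos[of 4] pos[of 6] in
      \<open>auto simp: C_def ACM_iff lines_meeting_simps[unfolded One_nat_def] line_indices_def\<close>)
next
  assume card: "card {j \<in> line_indices. a j = 0} \<ge> 2"
  \<comment> \<open>At most two weights are positive, so if both lines of a skew pair have positive
    weight, the other two weights vanish and the obstruction inequality holds automatically. Both
    sides then say that no skew pair lies in the support.\<close>
  have "\<not> (\<forall>j\<in>S. 0 < a j)" if "S \<subseteq> line_indices" "card S = 3" for S
  proof
    assume "\<forall>j\<in>S. 0 < a j"
    then have "card S \<le> card {j \<in> line_indices. 0 < a j}"
      using that by (intro card_mono) auto
    then show False using that card_support_le_2[OF card] by simp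
  qed
  from this[of "{1, 3, 4}"] this[of "{1, 3, 6}"] this[of "{1, 4, 6}"] this[of "{3, 4, 6}"]
  show "arithmetically_Cohen_Macaulay C \<longleftrightarrow> connectedin zariski (V C)"
    unfolding C_def ACM_iff connectedin_V_curve_ideal_iff[OF card]
    by (cases "a 1 = 0"; cases "a 3 = 0"; cases "a 4 = 0"; cases "a 6 = 0")
      (simp_all add: line_indices_def)
qed

end
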